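(* For every positive integer $k$, there exists a $k$-connected vertex-pancyclic graph that contains no pancyclic edge.
   Context: All graphs are finite and simple. An $m$-cycle is a cycle of length $m$ (as a subgraph). Let $G$ be a graph of order $n\ge 3$. A vertex $v$ of $G$ is pancyclic if it lies in an $m$-cycle of $G$ for every $m\in\{3,\ldots,n\}$; $G$ is vertex-pancyclic if every vertex of $G$ is pancyclic. An edge $e$ of $G$ is a pancyclic edge if, for every $m\in\{3,\ldots,n\}$, $e$ lies in an $m$-cycle of $G$. A graph $G$ is $k$-connected if $|V(G)|>k$ and deleting any set of at most $k-1$ vertices leaves the graph connected. *)

theory Defs
  imports "Graph_Theory.Graph_Theory"
begin

text \<open>
  A finite simple graph is the library's \<^locale>\<open>graph\<close>: a finite, loop-free, symmetric digraph
  without parallel arcs. An undirected edge is thus a pair of opposite arcs.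
\<close>

text \<open>
  The library's cycles are closed arc walks without repeated vertices, and in a symmetric digraph
  they include the closed walks of length 2 along a single edge. The bound on \<open>m\<close> excludes those.
\<close>
definition m_cycle :: "('a, 'b) pre_digraph \<Rightarrow> nat \<Rightarrow> 'b list \<Rightarrow> bool" where
  "m_cycle G m p \<longleftrightarrow> 3 \<le> m \<and> pre_digraph.cycle G p \<and> length p = m"

definition pancyclic_vertex :: "('a, 'b) pre_digraph \<Rightarrow> 'a \<Rightarrow> bool" where
  "pancyclic_vertex G v \<longleftrightarrow> v \<in> verts G \<and>
     (\<forall>m \<in> {3..card (verts G)}. \<exists>p. m_cycle G m p \<and> (\<exists>a \<in> set p. v \<in> {tail G a, head G a}))"

definition vertex_pancyclic :: "('a, 'b) pre_digraph \<Rightarrow> bool" where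
  "vertex_pancyclic G \<longleftrightarrow> (\<forall>v \<in> verts G. pancyclic_vertex G v)"

text \<open>
  The arc \<open>e\<close> represents the undirected edge joining its ends; a cycle contains that edge if it
  traverses it in either direction.
\<close>
definition pancyclic_edge :: "('a, 'b) pre_digraph \<Rightarrow> 'b \<Rightarrow> bool" where
  "pancyclic_edge G e \<longleftrightarrow> e \<in> arcs G \<and>
     (\<forall>m \<in> {3..card (verts G)}. \<exists>p. m_cycle G m p \<and>
        (\<exists>a \<in> set p. {tail G a, head G a} = {tail G e, head G e}))"

definition k_connected :: "nat \<Rightarrow> ('a, 'b) pre_digraph \<Rightarrow> bool" where
  "k_connected k G \<longleftrightarrow> k < card (verts G) \<and>
     (\<forall>S \<subseteq> verts G. card S \<le> k - 1 \<longrightarrow> connected (G \<restriction> (verts G - S)))"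

end

theory Submission
  imports Defs "HOL-Number_Theory.Cong" "HOL-Combinatorics.Transposition"
begin

text \<open>
  An edge is not pancyclic as soon as it misses one length, and the graph below is built so that
  every edge misses length 3 or length 4. Take three triangle-free graphs on a common index set that
  share no edge, place them in three disjoint layers, and join the three copies of every index by a
  triangle. An edge inside a layer then lies in no triangle (\<open>triangle_crosses\<close>): a vertex outside
  the layer has only one neighbour in it. An edge between two layers lies in no 4-cycle
  (\<open>four_cycle_stays_in_layer\<close>): the only way to close a 4-cycle across two layers would be to move
  along the same index edge in both; and as a 4-cycle through all three layers needs three crossing
  edges, its index would change at most once, so that its four vertices would share one index, of
  which there are only three copies.

  For the layers, split the complete graph on the integers modulo 7 into the three heptagons with
  differences \<open>\<plusminus>1\<close>, \<open>\<plusminus>2\<close>, \<open>\<plusminus>4\<close>, and replace each of the seven types by \<open>r\<close> copies, called levels. Thus a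
  vertex has a layer modulo 3, a type modulo 7 and a level below \<open>r\<close>; in layer \<open>l\<close> two vertices are
  adjacent when their types differ by \<open>\<plusminus>2^l\<close>, whatever their levels.

  Connectivity is high because a set of fewer than \<open>r\<close> vertices leaves some level untouched; such a
  level is connected, and every vertex has a neighbour on it (\<open>k_connected_adj\<close>).

  Cycles of all lengths come from paths inside a layer. From type \<open>s\<close> to type \<open>s + 2^l\<close>, with both ends
  on the same level, there is a path with \<open>m\<close> vertices for every \<open>m\<close> from 2 to \<open>7 * r\<close> except 3 and 5
  (\<open>layer_path\<close>). Its ends are adjacent, so it closes up to a cycle. Since \<open>1 + 2 + 4 = 7\<close>, one such
  path in each layer, taken in turn, returns to the initial type, and crossing edges join the
  three into one cycle; this gives the long cycles up to a Hamiltonian one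
  (\<open>cycle_through_vert\<close>). Only the lengths 3 and 5 are treated apart: a triangle of crossing edges, and
  the 5-cycle that makes two steps of \<open>2^l\<close> in one layer and one step back of twice that size in the
  next. All these cycles can be made to pass through any prescribed vertex.
\<close>

section \<open>Graphs given by an adjacency relation\<close>

definition rel_graph :: "'a set \<Rightarrow> ('a \<Rightarrow> 'a \<Rightarrow> bool) \<Rightarrow> ('a, 'a \<times> 'a) pre_digraph" where
  "rel_graph V E = \<lparr>verts = V, arcs = {(u, v). u \<in> V \<and> v \<in> V \<and> E u v}, tail = fst, head = snd\<rparr>"

lemma rel_graph_simps [simp]:
  "verts (rel_graph V E) = V"
  "arcs (rel_graph V E) = {(u, v). u \<in> V \<and> v \<in> V \<and> E u v}"
  "tail (rel_graph V E) = fst"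
  "head (rel_graph V E) = snd"
  by (simp_all add: rel_graph_def)

lemma graph_rel_graph:
  assumes "finite V" "symp E" "irreflp E"
  shows "graph (rel_graph V E)"
proof -
  have "{(u, v). u \<in> V \<and> v \<in> V \<and> E u v} \<subseteq> V \<times> V" by auto
  then have "finite {(u, v). u \<in> V \<and> v \<in> V \<and> E u v}"
    using assms(1) finite_subset by blast
  then show ?thesis
    using assms
    by unfold_locales
      (auto simp: arc_to_ends_def symmetric_conv dest: sympD irreflpD)
qed

text \<open>
  Cycles are built below as vertex lists, whereas \<^const>\<open>pre_digraph.cycle\<close> speaks of arc lists. This
  lemma and the next translate between the two.
\<close>

lemma awalk_of_vertex_list:
  assumes "ys \<noteq> []" "set ys \<subseteq> V" "successively E ys"
  shows "pre_digraph.awalk (rel_graph V E) (hd ys) (zip ys (tl ys)) (last ys)"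
    and "pre_digraph.awalk_verts (rel_graph V E) (hd ys) (zip ys (tl ys)) = ys"
proof -
  have "pre_digraph.awalk (rel_graph V E) (hd ys) (zip ys (tl ys)) (last ys) \<and>
    pre_digraph.awalk_verts (rel_graph V E) (hd ys) (zip ys (tl ys)) = ys"
    using assms
    by (induction ys rule: induct_list012)
      (auto simp: pre_digraph.awalk_def pre_digraph.cas.simps pre_digraph.awalk_verts.simps)
  then show "pre_digraph.awalk (rel_graph V E) (hd ys) (zip ys (tl ys)) (last ys)"
    and "pre_digraph.awalk_verts (rel_graph V E) (hd ys) (zip ys (tl ys)) = ys"
    by auto
qed

lemma m_cycle_of_vertex_list:
  assumes "3 \<le> length xs" "distinct xs" "set xs \<subseteq> V" "successively E xs" "E (last xs) (hd xs)"
    and "v \<in> set xs"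
  shows "\<exists>p. m_cycle (rel_graph V E) (length xs) p \<and>
    (\<exists>a \<in> set p. v \<in> {tail (rel_graph V E) a, head (rel_graph V E) a})"
proof -
  \<comment> \<open>The closed walk repeats its first vertex at the end.\<close>
  define ys where "ys = xs @ [hd xs]"
  define p where "p = zip ys (tl ys)"
  have ne: "xs \<noteq> []" using assms(1) by auto
  have ys: "ys \<noteq> []" "set ys \<subseteq> V" "successively E ys" "hd ys = hd xs" "last ys = hd xs"
    "tl ys = tl xs @ [hd xs]"
    using ne assms(3-5) by (auto simp: ys_def successively_append_iff)
  have "distinct (tl ys)"
    using ne assms(2) by (cases xs) (auto simp: ys_def)
  then have "pre_digraph.cycle (rel_graph V E) p"
    using awalk_of_vertex_list[OF ys(1-3)] ys(4,5) ne assms(1)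
    unfolding pre_digraph.cycle_def p_def
    by (intro exI[of _ "hd xs"]) (auto simp: ys_def)
  moreover have len: "length p = length xs"
    by (simp add: p_def ys_def)
  moreover have "map fst p = xs"
    by (simp add: p_def ys_def zip_append1 map_fst_zip_take)
  then have "v \<in> fst ` set p"
    using assms(6) by (metis list.set_map)
  ultimately show ?thesis
    using assms(1) by (auto simp: m_cycle_def)
qed

lemma arc_of_3_cycle:
  assumes "m_cycle (rel_graph V E) 3 p" "(x, y) \<in> set p"
  shows "\<exists>z. E x y \<and> E y z \<and> E z x"
proof -
  obtain a b c where "p = [a, b, c]"
    using assms(1) by (auto simp: m_cycle_def length_Suc_conv numeral_3_eq_3)
  then show ?thesis
    using assms
    by (auto simp: m_cycle_def pre_digraph.cycle_def pre_digraph.awalk_def pre_digraph.cas.simps)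
qed

lemma arc_of_4_cycle:
  assumes "m_cycle (rel_graph V E) 4 p" "(w, x) \<in> set p"
  shows "\<exists>y z. E w x \<and> E x y \<and> E y z \<and> E z w \<and> w \<noteq> y \<and> x \<noteq> z"
proof -
  obtain e1 e2 e3 e4 where p: "p = [e1, e2, e3, e4]"
    using assms(1) by (auto simp: m_cycle_def length_Suc_conv eval_nat_numeral)
  obtain a b c d where abcd: "p = [(a, b), (b, c), (c, d), (d, a)]"
    "E a b" "E b c" "E c d" "E d a" "a \<noteq> c" "b \<noteq> d"
    using assms(1) unfolding p
    by (cases e1, cases e2, cases e3, cases e4)
      (auto simp: m_cycle_def pre_digraph.cycle_def pre_digraph.awalk_def pre_digraph.cas.simps
        pre_digraph.awalk_verts.simps)
  then consider "w = a" "x = b" | "w = b" "x = c" | "w = c" "x = d" | "w = d" "x = a"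
    using assms(2) by auto
  then show ?thesis
    by cases (use abcd in metis)+
qed

section \<open>Three edge-disjoint blown-up heptagons\<close>

text \<open>
  Only the residues of \<open>s\<close> and \<open>t\<close> modulo 7 and of \<open>l\<close> modulo 3 matter, the latter because
  \<open>2^3 = 8\<close> is 1 modulo 7. So a vertex may stand for its own type, and layers may be counted on
  beyond 2.
\<close>

definition step :: "nat \<Rightarrow> nat \<Rightarrow> nat \<Rightarrow> bool" where
  "step l s t \<longleftrightarrow> [t = s + 2 ^ l] (mod 7) \<or> [s = t + 2 ^ l] (mod 7)"

definition cross :: "nat \<Rightarrow> nat \<Rightarrow> bool" where
  "cross u v \<longleftrightarrow> u mod 3 \<noteq> v mod 3 \<and> u mod 7 = v mod 7 \<and> u div 21 = v div 21"

text \<open>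
  A natural number encodes the vertex whose layer and type are its residues modulo 3 and 7 and whose
  level is its quotient by 21; the vertices with levels below \<open>r\<close> are then the numbers below
  \<open>21 * r\<close>.
\<close>

definition adj :: "nat \<Rightarrow> nat \<Rightarrow> bool" where
  "adj u v \<longleftrightarrow> u mod 3 = v mod 3 \<and> step (u mod 3) u v \<or> cross u v"

text \<open>
  The Chinese remainder theorem turns coordinates back into a number: 7 is 1 modulo 3 and 0 modulo 7,
  while 15 is 0 modulo 3 and 1 modulo 7.
\<close>

definition vert :: "nat \<Rightarrow> nat \<Rightarrow> nat \<Rightarrow> nat" where
  "vert l s c = 21 * c + (7 * l + 15 * s) mod 21"

lemma vert_coords [simp]:
  "vert l s c mod 3 = l mod 3" "vert l s c mod 7 = s mod 7" "vert l s c div 21 = c"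
proof -
  have reduce: "vert l s c mod n = (7 * l + 15 * s) mod n" if "n dvd 21" for n
  proof -
    have "vert l s c mod 21 mod n = (7 * l + 15 * s) mod 21 mod n"
      by (simp add: vert_def)
    then show ?thesis by (simp only: mod_mod_cancel[OF that])
  qed
  have "(l + 3 * (2 * l + 5 * s)) mod 3 = l mod 3" by (rule mod_mult_self2)
  then show "vert l s c mod 3 = l mod 3"
    using reduce[of 3] by (simp add: algebra_simps)
  have "(s + 7 * (l + 2 * s)) mod 7 = s mod 7" by (rule mod_mult_self2)
  then show "vert l s c mod 7 = s mod 7"
    using reduce[of 7] by (simp add: algebra_simps)
  show "vert l s c div 21 = c"
    by (simp add: vert_def)
qed

lemma eq_iff_coords:
  fixes u v :: nat
  shows "u = v \<longleftrightarrow> u mod 3 = v mod 3 \<and> u mod 7 = v mod 7 \<and> u div 21 = v div 21"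
proof -
  have "coprime (3::nat) 7" by code_simp
  then have "u mod 21 = v mod 21" if "u mod 3 = v mod 3" "u mod 7 = v mod 7"
    using that coprime_cong_mult_nat[of u v 3 7] by (simp add: cong_def)
  then show ?thesis by (metis div_mult_mod_eq)
qed

lemma vert_of_coords: "vert (v mod 3) (v mod 7) (v div 21) = v"
  by (subst eq_iff_coords) simp

lemma vert_less_iff [simp]: "vert l s c < 21 * r \<longleftrightarrow> c < r"
  using vert_coords(3)[of l s c] by (metis div_less_iff_less_mult mult.commute zero_less_numeral)

lemma power_2_mod_7: "(2::nat) ^ (l mod 3) mod 7 = 2 ^ l mod 7"
proof -
  have "(2::nat) ^ l = (2 ^ 3) ^ (l div 3) * 2 ^ (l mod 3)"
    by (metis div_mult_mod_eq mult.commute power_add power_mult)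
  then have "2 ^ l mod 7 = ((2 ^ 3) mod 7) ^ (l div 3) * 2 ^ (l mod 3) mod (7::nat)"
    by (metis mod_mult_left_eq power_mod)
  then show ?thesis by simp
qed

lemma step_cong:
  assumes "l mod 3 = l' mod 3" "s mod 7 = s' mod 7" "t mod 7 = t' mod 7"
  shows "step l s t \<longleftrightarrow> step l' s' t'"
proof -
  have pow: "(2::nat) ^ l mod 7 = 2 ^ l' mod 7"
    using assms(1) power_2_mod_7[of l] power_2_mod_7[of l'] by simp
  have "(s + 2 ^ l) mod 7 = (s' + 2 ^ l') mod 7" "(t + 2 ^ l) mod 7 = (t' + 2 ^ l') mod 7"
    by (intro mod_add_cong assms pow)+
  then show ?thesis
    by (simp only: step_def cong_def assms(2,3))
qed

lemma step_sym: "step l s t \<Longrightarrow> step l t s"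
  by (auto simp: step_def)

lemma step_0: "step 0 s t \<longleftrightarrow> (s + 1) mod 7 = t mod 7 \<or> (t + 1) mod 7 = s mod 7"
  by (simp only: step_def cong_def power_0 eq_commute)

text \<open>
  Multiplication by \<open>2^l\<close> carries the heptagon of layer 0 to that of layer \<open>l\<close>, so it suffices to
  find paths in the former.
\<close>

lemma step_affine:
  assumes "step 0 t t'"
  shows "step l (s + 2 ^ l * t) (s + 2 ^ l * t')"
proof -
  have *: "[s + 2 ^ l * b = s + 2 ^ l * a + 2 ^ l] (mod 7)" if "[b = a + 1] (mod 7)" for a b :: nat
  proof -
    have "[s + 2 ^ l * b = s + 2 ^ l * (a + 1)] (mod 7)"
      using that by (intro cong_add cong_mult) auto
    then show ?thesis by (simp add: algebra_simps)
  qed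
  show ?thesis
    using assms *[of t' t] *[of t t'] by (auto simp: step_def)
qed

lemma cong_add_complement:
  assumes "a + b = (7::nat)"
  shows "[s = t + a] (mod 7) \<longleftrightarrow> [t = s + b] (mod 7)"
proof -
  have "[s = t + a] (mod 7) \<longleftrightarrow> [s + b = t + a + b] (mod 7)"
    by (simp add: cong_add_rcancel_nat)
  also have "\<dots> \<longleftrightarrow> [s + b = t] (mod 7)"
    using assms by (simp add: cong_def add.assoc)
  finally show ?thesis by (auto simp: cong_sym_eq)
qed

lemma step_iff_difference:
  assumes "l < 3"
  shows "step l s t \<longleftrightarrow> (\<exists>x\<in>{2 ^ l, 7 - 2 ^ l}. [t = s + x] (mod 7))"
proof -
  have "(2::nat) ^ l + (7 - 2 ^ l) = 7"
    using assms by (auto simp: less_Suc_eq numeral_3_eq_3)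
  then show ?thesis
    using cong_add_complement[of "2 ^ l" "7 - 2 ^ l" s t] by (auto simp: step_def)
qed

lemma step_irrefl:
  assumes "step l s t"
  shows "s mod 7 \<noteq> t mod 7"
proof
  assume eq: "s mod 7 = t mod 7"
  have "step l s s"
    using assms step_cong[OF refl refl eq, of l s] by (simp only:)
  then have "[s + 2 ^ l = s] (mod 7)"
    unfolding step_def using cong_sym by auto
  then have "(7::nat) dvd 2 ^ l"
    by (simp only: cong_add_lcancel_0_nat cong_0_iff)
  moreover have "coprime (7::nat) (2 ^ l)" by simp
  ultimately have "is_unit (7::nat)" using coprime_absorb_left by blast
  then show False by simp
qed

text \<open>
  The sets \<open>{1, 6}\<close>, \<open>{2, 5}\<close>, \<open>{4, 3}\<close> of differences are disjoint, and none of them contains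
  three elements, repetitions allowed, with sum 0 modulo 7. Hence the three heptagons are edge-disjoint
  and triangle-free, and so are their blow-ups.
\<close>

lemma step_disjoint:
  assumes "step l s t" "step l' s' t'" "s mod 7 = s' mod 7" "t mod 7 = t' mod 7" "l < 3" "l' < 3"
  shows "l = l'"
proof -
  have "step l' s t"
    using assms(2) step_cong[OF refl assms(3,4), of l'] by (simp only:)
  then obtain x x' where x: "x \<in> {2 ^ l, 7 - 2 ^ l}" "x' \<in> {2 ^ l', 7 - 2 ^ l'}"
    "[t = s + x] (mod 7)" "[t = s + x'] (mod 7)"
    using assms(1) step_iff_difference[OF assms(5), of s t] step_iff_difference[OF assms(6), of s t]
    by blast
  have "[s + x = s + x'] (mod 7)"
    using cong_trans[OF cong_sym[OF x(3)] x(4)] .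
  then have "[x = x'] (mod 7)"
    by (simp only: cong_add_lcancel_nat)
  moreover have "l = 0 \<or> l = 1 \<or> l = 2" "l' = 0 \<or> l' = 1 \<or> l' = 2"
    using assms(5,6) by linarith+
  ultimately show ?thesis
    using x(1,2) by (elim disjE) (auto simp: cong_def)
qed

lemma step_triangle_free:
  assumes "step l a b" "step l b c" "step l c a" "l < 3"
  shows False
proof -
  obtain x y z where xyz: "x \<in> {2 ^ l, 7 - 2 ^ l}" "y \<in> {2 ^ l, 7 - 2 ^ l}" "z \<in> {2 ^ l, 7 - 2 ^ l}"
    "[b = a + x] (mod 7)" "[c = b + y] (mod 7)" "[a = c + z] (mod 7)"
    using assms(1-3) unfolding step_iff_difference[OF assms(4)] by blast
  have "[b + c + a = (a + x) + (b + y) + (c + z)] (mod 7)"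
    by (intro cong_add xyz(4-6))
  also have "(a + x) + (b + y) + (c + z) = (b + c + a) + (x + y + z)" by simp
  finally have "[(b + c + a) + (x + y + z) = b + c + a] (mod 7)"
    by (rule cong_sym)
  then have "[x + y + z = 0] (mod 7)"
    by (simp only: cong_add_lcancel_0_nat)
  moreover have "l = 0 \<or> l = 1 \<or> l = 2"
    using assms(4) by linarith
  ultimately show False
    using xyz(1-3) by (elim disjE) (auto simp: cong_def dest: dvd_imp_le)
qed

lemma symp_adj: "symp adj"
  by (rule sympI) (auto simp: adj_def cross_def intro: step_sym)

lemma irreflp_adj: "irreflp adj"
  by (rule irreflpI) (auto simp: adj_def cross_def dest: step_irrefl)

lemma adj_vert_layer: "step l s t \<Longrightarrow> adj (vert l s c) (vert l t d)"
  using step_cong[of "l mod 3" l "vert l s c" s "vert l t d" t] by (simp add: adj_def)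

lemma adj_vert_cross: "l mod 3 \<noteq> l' mod 3 \<Longrightarrow> s mod 7 = t mod 7 \<Longrightarrow> adj (vert l s c) (vert l' t c)"
  by (simp add: adj_def cross_def)

lemma step_add_power: "step l s (s + 2 ^ l)" "step l (s + 2 ^ l) s"
  by (auto simp: step_def)

section \<open>No edge lies both in a triangle and in a 4-cycle\<close>

lemma adj_same_layer: "adj u v \<Longrightarrow> u mod 3 = v mod 3 \<Longrightarrow> step (u mod 3) u v"
  by (simp add: adj_def cross_def)

lemma adj_other_layer: "adj u v \<Longrightarrow> u mod 3 \<noteq> v mod 3 \<Longrightarrow> u mod 7 = v mod 7 \<and> u div 21 = v div 21"
  by (simp add: adj_def cross_def)

text \<open>
  If \<open>x\<close> and \<open>y\<close> share a layer, a common neighbour in another layer would have the type of both; a common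
  neighbour in the same layer would be a triangle in a blown-up heptagon.
\<close>

lemma triangle_crosses:
  assumes "adj x y" "adj y z" "adj z x"
  shows "x mod 3 \<noteq> y mod 3"
proof
  assume eq: "x mod 3 = y mod 3"
  have xy: "step (x mod 3) x y" using adj_same_layer assms(1) eq .
  show False
  proof (cases "z mod 3 = x mod 3")
    case True
    have "step (x mod 3) y z"
      using adj_same_layer[OF assms(2)] eq True by (simp only:)
    moreover have "step (x mod 3) z x"
      using adj_same_layer[OF assms(3)] True by (simp only:)
    ultimately show ?thesis using step_triangle_free xy by (meson mod_less_divisor zero_less_numeral)
  next
    case False
    have "y mod 7 = z mod 7" using adj_other_layer[OF assms(2)] eq False by metis
    also have "z mod 7 = x mod 7" using adj_other_layer[OF assms(3)] False by blast
    finally show ?thesis using step_irrefl[OF xy] by simp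
  qed
qed

lemma third_layer:
  fixes w x y z :: nat
  assumes "w mod 3 \<noteq> x mod 3" "y mod 3 \<notin> {w mod 3, x mod 3}" "z mod 3 \<notin> {w mod 3, x mod 3}"
  shows "z mod 3 = y mod 3"
proof -
  have aux: "a < 3 \<Longrightarrow> b < 3 \<Longrightarrow> c < 3 \<Longrightarrow> d < 3 \<Longrightarrow> a \<noteq> b \<Longrightarrow> c \<noteq> a \<Longrightarrow> c \<noteq> b \<Longrightarrow> d \<noteq> a \<Longrightarrow> d \<noteq> b \<Longrightarrow> d = c"
    for a b c d :: nat by linarith
  show ?thesis
    by (rule aux[of "w mod 3" "x mod 3"]) (use assms in simp_all)
qed

text \<open>
  Suppose that \<open>w\<close> and \<open>x\<close> lie in different layers, hence agree in type and level. A vertex is determined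
  by its layer together with any crossing neighbour, so \<open>y\<close> avoids the layer of \<open>w\<close> and \<open>z\<close> that of \<open>x\<close>.
  If both \<open>x y\<close> and \<open>z w\<close> are layer edges, they join the same pair of types in different layers. In
  every other case exactly one layer edge is left, between two vertices of equal type.
\<close>

lemma four_cycle_stays_in_layer:
  assumes "adj w x" "adj x y" "adj y z" "adj z w" "w \<noteq> y" "x \<noteq> z"
  shows "w mod 3 = x mod 3"
proof (rule ccontr)
  assume ne: "w mod 3 \<noteq> x mod 3"
  have wx: "w mod 7 = x mod 7" "w div 21 = x div 21" using adj_other_layer[OF assms(1) ne] by blast+
  have y: "y mod 3 \<noteq> w mod 3"
  proof
    assume "y mod 3 = w mod 3"
    then have "w = y"
      using adj_other_layer[OF assms(2)] wx ne by (subst eq_iff_coords) metis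
    then show False using assms(5) by contradiction
  qed
  have z: "z mod 3 \<noteq> x mod 3"
  proof
    assume "z mod 3 = x mod 3"
    then have "x = z"
      using adj_other_layer[OF assms(4)] wx ne by (subst eq_iff_coords) metis
    then show False using assms(6) by contradiction
  qed
  have "x mod 7 = y mod 7 \<or> y mod 3 = x mod 3"
    using adj_other_layer[OF assms(2)] by metis
  moreover have "z mod 7 = w mod 7 \<or> z mod 3 = w mod 3"
    using adj_other_layer[OF assms(4)] by metis
  moreover have "y mod 7 = z mod 7 \<or> y mod 3 = z mod 3"
    using adj_other_layer[OF assms(3)] by metis
  ultimately consider (both) "y mod 3 = x mod 3" "z mod 3 = w mod 3"
    | (one) "y mod 3 = x mod 3" "x mod 7 = y mod 7"
    | (other) "z mod 3 = w mod 3" "z mod 7 = w mod 7"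
    | (third) "y mod 3 \<noteq> x mod 3" "z mod 3 \<noteq> w mod 3" "x mod 7 = y mod 7" "z mod 7 = w mod 7"
    using wx(1) y z ne by metis
  then show False
  proof cases
    case both
    have xy: "step (x mod 3) x y"
      using adj_same_layer[OF assms(2) both(1)[symmetric]] .
    have wz: "step (w mod 3) w z"
      using adj_same_layer[OF assms(4) both(2)] step_sym both(2) by metis
    have "y mod 7 = z mod 7"
      using adj_other_layer[OF assms(3)] both ne by metis
    then have "x mod 3 = w mod 3"
      using step_disjoint[OF xy wz wx(1)[symmetric]] by simp
    then show False using ne by simp
  next
    case one
    then show False using step_irrefl[OF adj_same_layer[OF assms(2)]] by metis
  next
    case other
    then show False using step_irrefl[OF adj_same_layer[OF assms(4)]] by metis
  next
    case third
    have "z mod 3 = y mod 3"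
      by (rule third_layer[OF ne]) (use y z third in simp_all)
    then have "step (y mod 3) y z" using adj_same_layer[OF assms(3)] by simp
    then show False using step_irrefl third(3,4) wx(1) by metis
  qed
qed

lemma no_pancyclic_edge:
  assumes "4 \<le> card V"
  shows "\<not> pancyclic_edge (rel_graph V adj) e"
proof
  let ?G = "rel_graph V adj"
  assume e: "pancyclic_edge ?G e"
  have cyc: "\<exists>p. m_cycle ?G m p \<and> (\<exists>a\<in>set p. {fst a, snd a} = {fst e, snd e})"
    if "3 \<le> m" "m \<le> 4" for m
  proof -
    have "m \<in> {3..card (verts ?G)}" using that assms by simp
    then show ?thesis using e unfolding pancyclic_edge_def rel_graph_simps by blast
  qed
  obtain p x y where p: "m_cycle ?G 3 p" "(x, y) \<in> set p" "{x, y} = {fst e, snd e}"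
    using cyc[of 3] by auto
  obtain q u v where q: "m_cycle ?G 4 q" "(u, v) \<in> set q" "{u, v} = {fst e, snd e}"
    using cyc[of 4] by auto
  have "x mod 3 \<noteq> y mod 3"
    using arc_of_3_cycle[OF p(1,2)] triangle_crosses by blast
  moreover have "u mod 3 = v mod 3"
    using arc_of_4_cycle[OF q(1,2)] four_cycle_stays_in_layer by blast
  moreover have "{x, y} = {u, v}" using p(3) q(3) by simp
  ultimately show False by (auto simp: doubleton_eq_iff)
qed

section \<open>Connectivity\<close>

text \<open>Each vertex spoils one level only.\<close>

lemma untouched_level:
  assumes "finite S" "card S < r"
  shows "\<exists>c<r. \<forall>v\<in>S. v div 21 \<noteq> (c::nat)"
proof (rule ccontr)
  assume "\<not> ?thesis"
  then have "{..<r} \<subseteq> (\<lambda>v. v div 21) ` S" by force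
  then have "r \<le> card S"
    using card_mono[of "(\<lambda>v. v div 21) ` S" "{..<r}"] card_image_le[OF assms(1), of "\<lambda>v. v div 21"] assms(1)
    by simp
  then show False using assms(2) by simp
qed

lemma k_connected_adj:
  assumes "1 \<le> k" "k \<le> r"
  shows "k_connected k (rel_graph {..<21 * r} adj)"
  unfolding k_connected_def
proof (intro conjI allI impI)
  show "k < card (verts (rel_graph {..<21 * r} adj))" using assms by simp
next
  fix S assume S: "S \<subseteq> verts (rel_graph {..<21 * r} adj)" "card S \<le> k - 1"
  let ?W = "{..<21 * r} - S"
  let ?H = "rel_graph {..<21 * r} adj \<restriction> ?W"
  have "finite S" using S(1) finite_subset by auto
  moreover have "card S < r" using S(2) assms by linarith
  ultimately obtain c where c: "c < r" "\<And>v. v \<in> S \<Longrightarrow> v div 21 \<noteq> c"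
    using untouched_level by blast
  have inW: "vert l s c \<in> ?W" for l s
    using c by (auto dest!: c(2))
  let ?R = "(arcs_ends ?H)\<^sup>s"
  have edge: "(u, v) \<in> ?R" "(v, u) \<in> ?R" if "u \<in> ?W" "v \<in> ?W" "adj u v" for u v
    using that by (force simp: symcl_def arcs_ends_conv)+
  let ?C = "rtrancl_on ?W ?R"
  have "sym ?R"
    by (rule symI) (auto simp: symcl_def)
  then have reversed: "(v, u) \<in> ?C" if "(u, v) \<in> ?C" for u v
    using that by (rule symD[OF rtrancl_on_sym])
  \<comment> \<open>Repeated steps of \<open>2^l\<close> reach every type of layer \<open>l\<close>, as \<open>2^l\<close> has the inverse \<open>4^l\<close> modulo 7.\<close>
  have walk: "(vert l 0 c, vert l (2 ^ l * j) c) \<in> ?C" for l j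
  proof (induction j)
    case 0
    then show ?case using inW by simp
  next
    case (Suc j)
    have "adj (vert l (2 ^ l * j) c) (vert l (2 ^ l * Suc j) c)"
      using adj_vert_layer step_add_power(1)[of l "2 ^ l * j"] by (simp add: add.commute)
    then show ?case using Suc edge inW by (meson rtrancl_on_into_rtrancl_on)
  qed
  have level: "(vert 0 0 c, vert l s c) \<in> ?C" if "l < 3" for l s
  proof -
    have start: "(vert 0 0 c, vert l 0 c) \<in> ?C"
    proof (cases "l = 0")
      case True
      then show ?thesis using inW by simp
    next
      case False
      then have "adj (vert 0 0 c) (vert l 0 c)" using that by (intro adj_vert_cross) auto
      then show ?thesis using edge inW by (meson rtrancl_on_into_rtrancl_on rtrancl_on_refl)
    qed
    have "vert l (2 ^ l * (4 ^ l * s)) c = vert l s c"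
    proof (subst eq_iff_coords, simp)
      have "(2::nat) ^ l * (4 ^ l * s) = 8 ^ l * s"
        by (simp flip: power_mult_distrib mult.assoc)
      also have "[8 ^ l * s = 1 ^ l * s] (mod 7)"
        by (intro cong_mult cong_pow) (auto simp: cong_def)
      finally show "2 ^ l * (4 ^ l * s) mod 7 = s mod 7" by (simp add: cong_def)
    qed
    then show ?thesis
      using rtrancl_on_trans[OF start walk[of l "4 ^ l * s"]] by simp
  qed
  have reach: "(vert 0 0 c, v) \<in> ?C" if "v \<in> ?W" for v
  proof -
    let ?l = "v mod 3" and ?s = "v mod 7"
    have "adj (vert ?l (?s + 2 ^ ?l) c) (vert ?l ?s (v div 21))"
      by (intro adj_vert_layer step_add_power)
    then have "adj (vert ?l (?s + 2 ^ ?l) c) v" by (simp add: vert_of_coords)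
    then show ?thesis
      using level[of ?l "?s + 2 ^ ?l"] edge inW that
      by (meson mod_less_divisor rtrancl_on_into_rtrancl_on zero_less_numeral)
  qed
  have "?W \<noteq> {}" using inW[of 0 0] by blast
  then have "verts ?H \<noteq> {}" by simp
  moreover have "(u, v) \<in> ?C" if "u \<in> ?W" "v \<in> ?W" for u v
    using reach[OF that(1)] reach[OF that(2)] reversed rtrancl_on_trans by metis
  ultimately show "connected (rel_graph {..<21 * r} adj \<restriction> (verts (rel_graph {..<21 * r} adj) - S))"
    unfolding connected_conv by simp
qed

section \<open>Paths in a blown-up heptagon\<close>

text \<open>
  The path that goes through the types \<open>ts\<close> once on each of the levels \<open>cs\<close>. With two adjacent types it
  zigzags between them and adds 2 vertices per level; with all seven types it winds around the
  heptagon and adds 7.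
\<close>

definition sweep :: "'a list \<Rightarrow> 'b list \<Rightarrow> ('a \<times> 'b) list" where
  "sweep ts cs = concat (map (\<lambda>c. map (\<lambda>t. (t, c)) ts) cs)"

abbreviation heptagon_path :: "(nat \<times> nat) list \<Rightarrow> bool" where
  "heptagon_path p \<equiv> distinct p \<and> successively (\<lambda>x y. step 0 (fst x) (fst y)) p"

lemma sweep_simps [simp]: "sweep ts [] = []" "sweep ts (c # cs) = map (\<lambda>t. (t, c)) ts @ sweep ts cs"
  by (simp_all add: sweep_def)

lemma length_sweep [simp]: "length (sweep ts cs) = length ts * length cs"
  by (induction cs) auto

lemma set_sweep [simp]: "set (sweep ts cs) = set ts \<times> set cs"
  by (induction cs) auto

lemma distinct_sweep [simp]: "distinct ts \<Longrightarrow> distinct cs \<Longrightarrow> distinct (sweep ts cs)"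
  by (induction cs) (auto simp: distinct_map inj_on_def)

lemma sweep_eq_Nil_iff [simp]: "sweep ts cs = [] \<longleftrightarrow> ts = [] \<or> cs = []"
  by (cases cs) (auto simp: sweep_def)

lemma hd_sweep [simp]: "ts \<noteq> [] \<Longrightarrow> cs \<noteq> [] \<Longrightarrow> hd (sweep ts cs) = (hd ts, hd cs)"
  by (cases cs) (auto simp: hd_map)

lemma last_sweep [simp]: "ts \<noteq> [] \<Longrightarrow> cs \<noteq> [] \<Longrightarrow> last (sweep ts cs) = (last ts, last cs)"
  by (induction cs) (auto simp: last_map)

lemma successively_sweep:
  assumes "ts \<noteq> []" "successively P ts" "P (last ts) (hd ts)"
  shows "successively (\<lambda>x y. P (fst x) (fst y)) (sweep ts cs)"
proof (induction cs)
  case (Cons c cs)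
  then show ?case
    using assms
    by (cases "cs = []") (simp_all add: successively_append_iff successively_map last_map)
qed simp

text \<open>A zigzag between the types 0 and 1, arranged so that both ends lie on level 0.\<close>

lemma even_heptagon_path:
  assumes "1 \<le> j" "j \<le> r"
  shows "\<exists>p. heptagon_path p \<and> length p = 2 * j \<and> hd p = (0, 0) \<and> last p = (1, 0) \<and>
    set p \<subseteq> {..<7} \<times> {..<r}"
proof -
  define p where "p = (0, 0) # sweep [1, 0] [1..<j] @ [(1::nat, 0::nat)]"
  have "successively (\<lambda>x y. step 0 (fst x) (fst y)) (sweep [1, 0] [1..<j])"
    by (rule successively_sweep) (simp_all add: step_0)
  moreover have "step 0 0 1" by (simp add: step_0)
  ultimately have "successively (\<lambda>x y. step 0 (fst x) (fst y)) p"
    unfolding p_def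
    by (cases "j = 1") (simp_all add: assms successively_append_iff successively_Cons hd_append)
  moreover have "distinct p" "length p = 2 * j" "hd p = (0, 0)" "last p = (1, 0)"
    "set p \<subseteq> {..<7} \<times> {..<r}"
    using assms unfolding p_def by auto
  ultimately show ?thesis by blast
qed

text \<open>
  The path goes once around the heptagon on level 0, from type 0 down through 6, 5, \<open>\<dots>\<close> to type 1, and is
  lengthened in two ways. Before the final vertex it makes \<open>d - 1\<close> full turns on the levels from 1 to
  \<open>d - 1\<close>; these change the parity of the length and collect the vertices of type 1, which no zigzag visits.
  The pairs of types (0, 6), (5, 4) and (3, 2) are stretched to zigzags over \<open>i1\<close>, \<open>i2\<close> and \<open>i3\<close> further
  levels, all at least \<open>d\<close>.
\<close>

lemma long_heptagon_path:
  assumes "1 \<le> d" "d \<le> r" "i1 + d \<le> r" "i2 + d \<le> r" "i3 + d \<le> r"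
  shows "\<exists>p. heptagon_path p \<and> length p = 7 * d + 2 * (i1 + i2 + i3) \<and> hd p = (0, 0) \<and> last p = (1, 0) \<and>
    set p \<subseteq> {..<7} \<times> {..<r}"
proof -
  define p1 where "p1 = sweep [0::nat, 6] (0 # [d..<d + i1])"
  define p2 where "p2 = sweep [5::nat, 4] (0 # [d..<d + i2])"
  define p3 where "p3 = sweep [3::nat, 2] (0 # [d..<d + i3])"
  define p4 where "p4 = sweep [1::nat, 0, 6, 5, 4, 3, 2] [1..<d]"
  let ?p = "p1 @ p2 @ p3 @ p4 @ [(1, 0)]"
  let ?R = "\<lambda>x y. step 0 (fst x) (fst y)"
  note defs = p1_def p2_def p3_def p4_def
  have walks: "successively ?R p1" "successively ?R p2" "successively ?R p3" "successively ?R p4"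
    unfolding defs by (rule successively_sweep; simp add: step_0)+
  have ends: "p1 \<noteq> []" "fst (last p1) = 6" "p2 \<noteq> []" "fst (hd p2) = 5" "fst (last p2) = 4"
    "p3 \<noteq> []" "fst (hd p3) = 3" "fst (last p3) = 2"
    "p4 \<noteq> [] \<Longrightarrow> fst (hd p4) = 1 \<and> fst (last p4) = 2"
    unfolding defs by (simp_all del: sweep_simps)
  have turns: "step 0 6 5" "step 0 4 3" "step 0 2 1" by (simp_all add: step_0)
  have "successively ?R ?p"
    using walks ends turns by (cases "p4 = []") (simp_all add: successively_append_iff)
  moreover have "length ?p = 7 * d + 2 * (i1 + i2 + i3)"
    using assms(1) unfolding defs by (simp del: sweep_simps)
  moreover have "distinct p1" "distinct p2" "distinct p3" "distinct p4"
    unfolding defs using assms(1) by (simp_all del: sweep_simps)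
  then have "distinct ?p"
    unfolding distinct_append by (auto simp: defs simp del: sweep_simps)
  moreover have "hd ?p = (0, 0)" "last ?p = (1, 0)"
    unfolding p1_def by simp_all
  moreover have "set ?p \<subseteq> {..<7} \<times> {..<r}"
    using assms unfolding defs by (auto simp del: sweep_simps)
  ultimately show ?thesis by blast
qed

text \<open>
  With \<open>d\<close> turns in all, the path above has any length of the parity of \<open>d\<close> between \<open>7 * d\<close> and \<open>6 * r + d\<close>.
  The choices \<open>d = 1\<close> and \<open>d = 2\<close> cover the lengths up to \<open>6 * r + 1\<close>, apart from the even ones below 14;
  those are zigzags, for which \<open>r \<ge> 7\<close> leaves enough levels. A greater length
  \<open>6 * r + d\<close> arises from \<open>d\<close> turns with full zigzags.
\<close>

lemma heptagon_path_exists: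
  assumes "7 \<le> r" "2 \<le> m" "m \<le> 7 * r" "m \<noteq> 3" "m \<noteq> 5"
  shows "\<exists>p. heptagon_path p \<and> length p = m \<and> hd p = (0, 0) \<and> last p = (1, 0) \<and>
    set p \<subseteq> {..<7} \<times> {..<r}"
proof (cases "even m \<and> m \<le> 2 * r")
  case True
  then obtain j where "m = 2 * j" by (auto elim: evenE)
  then show ?thesis using even_heptagon_path[of j r] True assms(2) by simp
next
  case False
  have "\<exists>d j. 1 \<le> d \<and> d \<le> r \<and> m = 7 * d + 2 * j \<and> j \<le> 3 * (r - d)"
  proof (cases "m \<le> 6 * r + 1")
    case small: True
    show ?thesis
    proof (cases "even m")
      case True
      then obtain i where "m = 2 * i" by (auto elim: evenE)
      then show ?thesis
        using False small assms(1) True by (intro exI[of _ 2] exI[of _ "i - 7"]) auto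
    next
      case odd: False
      then obtain i where "m = 2 * i + 1" by (auto elim: oddE)
      then show ?thesis
        using small assms by (intro exI[of _ 1] exI[of _ "i - 3"]) auto
    qed
  next
    case large: False
    then show ?thesis
      using assms(3) by (intro exI[of _ "m - 6 * r"] exI[of _ "3 * (r - (m - 6 * r))"]) auto
  qed
  then obtain d j where d: "1 \<le> d" "d \<le> r" "m = 7 * d + 2 * j" "j \<le> 3 * (r - d)"
    by blast
  \<comment> \<open>Fill the three zigzags greedily.\<close>
  define i1 where "i1 = min j (r - d)"
  define i2 where "i2 = min (j - i1) (r - d)"
  have "i1 + d \<le> r" "i2 + d \<le> r" "(j - i1 - i2) + d \<le> r" "i1 + i2 + (j - i1 - i2) = j"
    using d unfolding i1_def i2_def by auto
  then show ?thesis using long_heptagon_path[of d r i1 i2 "j - i1 - i2"] d(1-3) by simp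
qed

text \<open>
  The heptagon path is moved by an affine map of the types, and by the exchange of the levels 0 and \<open>c\<close>
  so that its ends lie on level \<open>c\<close>.
\<close>

lemma layer_path:
  assumes "7 \<le> r" "2 \<le> m" "m \<le> 7 * r" "m \<noteq> 3" "m \<noteq> 5" "c < r"
  shows "\<exists>p. length p = m \<and> distinct p \<and> successively adj p \<and>
    hd p = vert l s c \<and> last p = vert l (s + 2 ^ l) c \<and>
    set p \<subseteq> {v. v < 21 * r \<and> v mod 3 = l mod 3}"
proof -
  obtain q where q: "heptagon_path q" "length q = m" "hd q = (0, 0)" "last q = (1, 0)"
    "set q \<subseteq> {..<7} \<times> {..<r}"
    using heptagon_path_exists assms by metis
  define f where "f = (\<lambda>(t, i). vert l (s + 2 ^ l * t) (transpose 0 c i))"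
  have inj: "inj_on f ({..<7} \<times> {..<r})"
  proof (rule inj_onI)
    fix x y assume xy: "x \<in> {..<7} \<times> {..<r}" "y \<in> {..<7} \<times> {..<r}" "f x = f y"
    obtain t i u j where tu: "x = (t, i)" "y = (u, j)" by (cases x, cases y) auto
    from xy(3) have eq: "transpose 0 c i = transpose 0 c j" "[s + 2 ^ l * t = s + 2 ^ l * u] (mod 7)"
      unfolding tu f_def cong_def using vert_coords by (metis case_prod_conv)+
    have "coprime (2 ^ l) (7::nat)"
      by simp
    then have "[t = u] (mod 7)"
      using eq(2) cong_add_lcancel_nat cong_mult_lcancel_nat by blast
    then have "t = u" using xy(1,2) tu by (simp add: cong_def)
    moreover have "i = j" using eq(1) by (metis transpose_involutory)
    ultimately show "x = y" using tu by simp
  qed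
  have "q \<noteq> []" using q(2) assms(2) by auto
  then have "hd (map f q) = vert l s c" "last (map f q) = vert l (s + 2 ^ l) c"
    using q(3,4) by (simp_all add: hd_map last_map f_def)
  moreover have "length (map f q) = m" "distinct (map f q)"
    using q(1,2) inj_on_subset[OF inj q(5)] by (simp_all add: distinct_map)
  moreover have "adj (f x) (f y)" if "step 0 (fst x) (fst y)" for x y
    unfolding f_def case_prod_beta by (intro adj_vert_layer step_affine that)
  then have "successively adj (map f q)"
    unfolding successively_map by (intro successively_mono[OF conjunct2[OF q(1)]])
  moreover have "set (map f q) \<subseteq> {v. v < 21 * r \<and> v mod 3 = l mod 3}"
    using q(5) assms(6) by (auto simp: f_def transpose_def)
  ultimately show ?thesis by blast
qed

section \<open>Cycles of all lengths\<close>

text \<open>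
  The cycles are built from an arbitrary vertex as starting point. For lengths above \<open>7 * r\<close> the three
  pieces have at least 6 vertices each, which steers clear of the impossible path lengths 3 and 5.
\<close>

lemma cycle_through_vert:
  assumes "7 \<le> r" "c < r" "3 \<le> m" "m \<le> 21 * r"
  shows "\<exists>xs. length xs = m \<and> distinct xs \<and> set xs \<subseteq> {..<21 * r} \<and> successively adj xs \<and>
    adj (last xs) (hd xs) \<and> vert l s c \<in> set xs"
proof -
  have mod3: "l mod 3 \<noteq> (l + 1) mod 3" "(l + 1) mod 3 \<noteq> (l + 2) mod 3" "(l + 2) mod 3 \<noteq> l mod 3"
    by presburger+
  note adjs = adj_vert_cross adj_vert_layer step_add_power
  consider "m = 3" | "m = 5" | "m \<noteq> 3" "m \<noteq> 5" "m \<le> 7 * r" | "7 * r < m"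
    by linarith
  then show ?thesis
  proof cases
    case 1
    then show ?thesis
      using assms(2) mod3
      by (intro exI[of _ "[vert l s c, vert (l + 1) s c, vert (l + 2) s c]"])
        (auto intro!: adjs simp: eq_iff_coords[of "vert _ _ _"])
  next
    case 2
    \<comment> \<open>Two steps of \<open>2^l\<close> in layer \<open>l\<close> are undone by one step in layer \<open>l + 1\<close>.\<close>
    let ?d = "2 ^ l :: nat"
    have "s mod 7 \<noteq> (s + ?d) mod 7" "(s + ?d) mod 7 \<noteq> (s + ?d + ?d) mod 7"
      by (rule step_irrefl[OF step_add_power(1)])+
    moreover have return: "step (l + 1) (s + ?d + ?d) s"
      using step_add_power(2)[of "l + 1" s] by (simp add: add.assoc mult_2)
    moreover have "s mod 7 \<noteq> (s + ?d + ?d) mod 7"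
      using step_irrefl[OF return] by simp
    ultimately show ?thesis
      using assms(2) mod3 2
      by (intro exI[of _ "[vert l s c, vert l (s + ?d) c, vert l (s + ?d + ?d) c,
            vert (l + 1) (s + ?d + ?d) c, vert (l + 1) s c]"])
        (auto intro!: adjs simp: eq_iff_coords[of "vert _ _ _"])
  next
    case 3
    then obtain p where p: "length p = m" "distinct p" "successively adj p" "hd p = vert l s c"
      "last p = vert l (s + 2 ^ l) c" "set p \<subseteq> {v. v < 21 * r \<and> v mod 3 = l mod 3}"
      using layer_path[of r m c l s] assms by auto
    have "vert l s c \<in> set p" using p(1,4) assms(3) by (metis hd_in_set list.size(3) not_numeral_le_zero)
    then show ?thesis using p by (intro exI[of _ p]) (auto intro!: adjs)
  next
    case 4
    define m1 where "m1 = min (7 * r) (m - 12)"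
    define m2 where "m2 = min (7 * r) (m - m1 - 6)"
    define m3 where "m3 = m - m1 - m2"
    have m: "6 \<le> m1" "m1 \<le> 7 * r" "6 \<le> m2" "m2 \<le> 7 * r" "6 \<le> m3" "m3 \<le> 7 * r" "m1 + m2 + m3 = m"
      using 4 assms(1,4) unfolding m1_def m2_def m3_def by linarith+
    let ?s1 = "s + 2 ^ l" let ?s2 = "?s1 + 2 ^ (l + 1)" let ?s3 = "?s2 + 2 ^ (l + 2)"
    obtain p1 where p1: "length p1 = m1" "distinct p1" "successively adj p1" "hd p1 = vert l s c"
      "last p1 = vert l ?s1 c" "set p1 \<subseteq> {v. v < 21 * r \<and> v mod 3 = l mod 3}"
      using layer_path[of r m1 c l s] assms m by auto
    obtain p2 where p2: "length p2 = m2" "distinct p2" "successively adj p2"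
      "hd p2 = vert (l + 1) ?s1 c" "last p2 = vert (l + 1) ?s2 c"
      "set p2 \<subseteq> {v. v < 21 * r \<and> v mod 3 = (l + 1) mod 3}"
      using layer_path[of r m2 c "l + 1" ?s1] assms m by auto
    obtain p3 where p3: "length p3 = m3" "distinct p3" "successively adj p3"
      "hd p3 = vert (l + 2) ?s2 c" "last p3 = vert (l + 2) ?s3 c"
      "set p3 \<subseteq> {v. v < 21 * r \<and> v mod 3 = (l + 2) mod 3}"
      using layer_path[of r m3 c "l + 2" ?s2] assms m by auto
    have ne: "p1 \<noteq> []" "p2 \<noteq> []" "p3 \<noteq> []" using p1(1) p2(1) p3(1) m by auto
    have "?s3 = s + 7 * 2 ^ l" by simp
    then have "?s3 mod 7 = s mod 7" by presburger
    then have close: "adj (vert (l + 2) ?s3 c) (vert l s c)" using mod3 by (intro adj_vert_cross) auto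
    have join: "adj (vert l ?s1 c) (vert (l + 1) ?s1 c)" "adj (vert (l + 1) ?s2 c) (vert (l + 2) ?s2 c)"
      using mod3 by (auto intro!: adj_vert_cross)
    have "vert l s c \<in> set p1" using ne p1(4) by (metis hd_in_set)
    moreover have "distinct (p1 @ p2 @ p3)"
      using p1(2,6) p2(2,6) p3(2,6) mod3 by fastforce
    moreover have "successively adj (p1 @ p2 @ p3)"
      using p1 p2 p3 ne join by (simp add: successively_append_iff)
    moreover have "adj (last (p1 @ p2 @ p3)) (hd (p1 @ p2 @ p3))"
      using p1 p3 ne close by simp
    moreover have "length (p1 @ p2 @ p3) = m" "set (p1 @ p2 @ p3) \<subseteq> {..<21 * r}"
      using p1 p2 p3 m by auto
    ultimately show ?thesis by (intro exI[of _ "p1 @ p2 @ p3"]) auto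
  qed
qed

lemma vertex_pancyclic_adj:
  assumes "7 \<le> r"
  shows "vertex_pancyclic (rel_graph {..<21 * r} adj)"
  unfolding vertex_pancyclic_def pancyclic_vertex_def
proof (intro ballI conjI)
  fix v m assume v: "v \<in> verts (rel_graph {..<21 * r} adj)"
    and m: "m \<in> {3..card (verts (rel_graph {..<21 * r} adj))}"
  have "v div 21 < r" using v by (simp add: div_less_iff_less_mult mult.commute)
  then obtain xs where "length xs = m" "distinct xs" "set xs \<subseteq> {..<21 * r}" "successively adj xs"
    "adj (last xs) (hd xs)" "v \<in> set xs"
    using cycle_through_vert[of r "v div 21" m "v mod 3" "v mod 7"] assms m
    by (auto simp: vert_of_coords)
  then show "\<exists>p. m_cycle (rel_graph {..<21 * r} adj) m p \<and>
      (\<exists>a\<in>set p. v \<in> {tail (rel_graph {..<21 * r} adj) a, head (rel_graph {..<21 * r} adj) a})"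
    using m_cycle_of_vertex_list[of xs "{..<21 * r}" adj v] m by auto
qed

theorem theorem1:
  fixes k :: nat
  assumes "k \<ge> 1"
  shows "\<exists>G :: (nat, nat \<times> nat) pre_digraph.
    graph G \<and> 3 \<le> card (verts G) \<and> k_connected k G \<and> vertex_pancyclic G \<and>
    (\<forall>e \<in> arcs G. \<not> pancyclic_edge G e)"
proof (intro exI conjI ballI)
  let ?G = "rel_graph {..<21 * (k + 7)} adj"
  show "graph ?G" using graph_rel_graph symp_adj irreflp_adj by blast
  show "3 \<le> card (verts ?G)" by simp
  show "k_connected k ?G" using k_connected_adj[of k "k + 7"] assms by simp
  show "vertex_pancyclic ?G" using vertex_pancyclic_adj[of "k + 7"] by simp
  show "\<not> pancyclic_edge ?G e" for e using no_pancyclic_edge[of "{..<21 * (k + 7)}"] by simp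
qed

end
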